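(* Let $N\geq4$ be an integer and let $\zeta=e^{2\pi i/(N-1)^4}$, or any other primitive root of unity of order $(N-1)^4$. Then the vector $$(1,\zeta,\zeta^4,\zeta^9,\dots,\zeta^{(N-1)^2})\in\mathbb{C}^N$$ generates a Gabor frame in general linear position.
   Context: Let $\omega=e^{2\pi i/N}$. Define the linear operators $T,M:\mathbb{C}^N\to\mathbb{C}^N$ by $$T(x_0,x_1,\dots,x_{N-1})=(x_{N-1},x_0,\dots,x_{N-2}),\qquad M(x_0,x_1,\dots,x_{N-1})=(x_0,\omega x_1,\dots,\omega^{N-1}x_{N-1}),$$ and for $(\kappa,\lambda)\in(\mathbb{Z}/N\mathbb{Z})^2$ put $\pi(\kappa,\lambda)=M^{\lambda}T^{\kappa}$. A vector $\varphi\in\mathbb{C}^N$ generates a Gabor frame in general linear position if for every $\Lambda\subseteq(\mathbb{Z}/N\mathbb{Z})^2$ with $|\Lambda|=N$ the family $(\pi(\kappa,\lambda)\varphi)_{(\kappa,\lambda)\in\Lambda}$ is a basis of $\mathbb{C}^N$. The $n$-th coordinate ($0\le n\le N-1$) of the vector in the claim is $\zeta^{n^2}$. *)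

theory Defs
  imports Complex_Main "Jordan_Normal_Form.VS_Connect"
begin

definition shift_op :: "nat \<Rightarrow> complex vec \<Rightarrow> complex vec" where
  "shift_op N x = Matrix.vec N (\<lambda>n. vec_index x ((n + N - 1) mod N))"

definition modulation_op :: "nat \<Rightarrow> complex vec \<Rightarrow> complex vec" where
  "modulation_op N x =
     Matrix.vec N (\<lambda>n. exp (2 * complex_of_real pi * \<i> / of_nat N) ^ n * vec_index x n)"

text \<open>Elements of \<open>\<int>/N\<int>\<close> are represented by \<open>0, \<dots>, N - 1\<close>. On \<open>\<complex>\<^sup>N\<close> the N-th iterates of
  both operators are the identity, so no choice is involved; see
  \<open>time_freq_shift_mod\<close> below.\<close>

definition time_freq_shift :: "nat \<Rightarrow> nat \<times> nat \<Rightarrow> complex vec \<Rightarrow> complex vec" where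
  "time_freq_shift N = (\<lambda>(\<kappa>, l). (modulation_op N ^^ l) \<circ> (shift_op N ^^ \<kappa>))"

text \<open>A family is a basis when it is one as a family, not just as a set of values: repeated
  vectors are excluded by injectivity.\<close>

definition basis_family :: "nat \<Rightarrow> 'i set \<Rightarrow> ('i \<Rightarrow> complex vec) \<Rightarrow> bool" where
  "basis_family N I f \<longleftrightarrow>
     inj_on f I \<and> vectorspace.basis class_ring (module_vec TYPE(complex) N) (f ` I)"

definition gabor_general_linear_position :: "nat \<Rightarrow> complex vec \<Rightarrow> bool" where
  "gabor_general_linear_position N \<phi> \<longleftrightarrow>
     \<phi> \<in> carrier_vec N \<and>
     (\<forall>L \<subseteq> {0..<N} \<times> {0..<N}. card L = N \<longrightarrow>
        basis_family N L (\<lambda>p. time_freq_shift N p \<phi>))"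

definition primitive_root_of_unity :: "nat \<Rightarrow> complex \<Rightarrow> bool" where
  "primitive_root_of_unity m z \<longleftrightarrow>
     m > 0 \<and> z ^ m = 1 \<and> (\<forall>k. 0 < k \<and> k < m \<longrightarrow> z ^ k \<noteq> 1)"

lemma shift_op_funpow:
  assumes "x \<in> carrier_vec N" "N > 0"
  shows "(shift_op N ^^ k) x = Matrix.vec N (\<lambda>n. vec_index x (nat ((int n - int k) mod int N)))"
proof (induction k)
  case 0
  show ?case using assms by (intro eq_vecI) auto
next
  case (Suc k)
  have idx: "(int ((n + N - 1) mod N) - int k) mod int N = (int n - int (Suc k)) mod int N" for n
  proof -
    have "int ((n + N - 1) mod N) = (int n - 1 + int N) mod int N"
      using assms(2) by (simp add: zmod_int of_nat_diff algebra_simps)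
    also have "\<dots> = (int n - 1) mod int N" by simp
    finally show ?thesis by (simp add: mod_diff_left_eq algebra_simps)
  qed
  have step: "(shift_op N ^^ Suc k) x =
      shift_op N (Matrix.vec N (\<lambda>n. vec_index x (nat ((int n - int k) mod int N))))"
    by (simp add: Suc.IH)
  show ?case
    unfolding step using assms(2) idx by (intro eq_vecI) (simp_all add: shift_op_def)
qed

lemma modulation_op_funpow:
  assumes "x \<in> carrier_vec N"
  shows "(modulation_op N ^^ k) x =
    Matrix.vec N (\<lambda>n. exp (2 * complex_of_real pi * \<i> / of_nat N) ^ (n * k) * vec_index x n)"
proof (induction k)
  case 0
  show ?case using assms by (intro eq_vecI) auto
next
  case (Suc k)
  have step: "(modulation_op N ^^ Suc k) x = modulation_op N (Matrix.vec N
      (\<lambda>n. exp (2 * complex_of_real pi * \<i> / of_nat N) ^ (n * k) * vec_index x n))"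
    by (simp add: Suc.IH)
  show ?case
    unfolding step by (intro eq_vecI) (simp_all add: modulation_op_def power_add)
qed

lemma time_freq_shift_mod:
  assumes "x \<in> carrier_vec N" "N > 0"
  shows "time_freq_shift N (k mod N, l mod N) x = time_freq_shift N (k, l) x"
proof -
  define w where "w = exp (2 * complex_of_real pi * \<i> / of_nat N)"
  have "w ^ N = 1"
    using assms(2) by (simp add: w_def flip: exp_of_nat_mult)
  then have w: "w ^ (n * (l mod N)) = w ^ (n * l)" for n
    by (metis mult.commute power_mult power_one mult_1 power_add mult_div_mod_eq)
  have "(shift_op N ^^ (k mod N)) x = (shift_op N ^^ k) x"
    using assms by (simp add: shift_op_funpow zmod_int mod_diff_right_eq)
  moreover have "(shift_op N ^^ k) x \<in> carrier_vec N"
    using assms by (simp add: shift_op_funpow)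
  ultimately show ?thesis
    by (simp add: time_freq_shift_def modulation_op_funpow w flip: w_def)
qed

end

theory Submission
  imports "HOL-Number_Theory.Residues" "Jordan_Normal_Form.DL_Rank" "Jordan_Normal_Form.Char_Poly" Defs
begin

text \<open>Fix a set \<open>\<Lambda>\<close> of \<open>N\<close> time-frequency shifts \<open>(\<kappa>\<^sub>j, \<lambda>\<^sub>j)\<close>, put \<open>m = N - 1\<close>, and let \<open>\<omega>\<close> be the primitive
  \<open>N\<close>-th root of unity that defines the modulations. The shifted vectors form a basis iff the
  determinant with entries \<open>\<omega>\<close> to the power \<open>\<lambda>\<^sub>j r\<close> times \<open>\<zeta>\<close> to the power \<open>((r - \<kappa>\<^sub>j) mod N)\<^sup>2\<close> is nonzero. It is
  the value at \<open>\<zeta>\<close> of a polynomial \<open>D\<close> over \<open>\<int>[\<omega>]\<close> of degree at most \<open>N m\<^sup>2\<close>, and the proof has two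
  independent halves.

  \<^bold>\<open>The polynomial \<open>D\<close> is not zero.\<close> A term of the Leibniz expansion is an assignment of the rows \<open>r\<close> to
  the shifts, and its exponent is the sum of the squared waiting times when a shift with \<open>\<kappa>\<^sub>j = \<kappa>\<close>
  is a customer that arrives at time \<open>\<kappa>\<close> on a circular clock. There are as many customers as slots, so by the
  cycle lemma (\<open>cyclic_sorted_enumeration\<close>) the clock can be cut open at a point where the queue is
  empty. Convexity of the square then makes the first-come-first-served order optimal, and uniquely so
  up to exchanging customers with the same \<open>\<kappa>\<close> (\<open>queue_cost_minimal\<close>). In that order each \<open>\<kappa>\<close> is
  served in consecutive slots, so the lowest coefficient of \<open>D\<close> is, up to sign and powers of \<open>\<omega>\<close>, a product of
  Vandermonde determinants with distinct nodes (\<open>block_vandermonde_det_nonzero\<close>, \<open>gabor_det_poly_nonzero\<close>).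

  \<^bold>\<open>The polynomial \<open>D\<close> does not vanish at \<open>\<zeta>\<close>.\<close> The orders \<open>N\<close> and \<open>m\<^sup>4\<close> are coprime, so conjugations can fix
  \<open>\<omega>\<close> and send \<open>\<zeta>\<close> to any other primitive root of order \<open>m\<^sup>4\<close> (\<open>det_root_powers_conjugate\<close>, which rests on
  the classical argument for the irreducibility of cyclotomic polynomials,
  \<open>int_poly_root_prime_power\<close>). If \<open>D\<close> vanished at \<open>\<zeta>\<close> it would thus have \<open>m\<^sup>3 \<phi>(m)\<close> roots, where \<open>\<phi>\<close> is
  Euler's totient function, which is more than its degree allows (\<open>gabor_det_nonzero\<close>).\<close>

section \<open>Conjugation of roots of unity\<close>

lemma prime_dvd_power_add:
  fixes a b :: "int poly"
  assumes "prime p"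
  shows "[:int p:] dvd (a + b) ^ p - (a ^ p + b ^ p)"
proof -
  have p: "p > 0" using assms prime_gt_0_nat by blast
  have "(a + b) ^ p = (\<Sum>k\<le>p. of_nat (p choose k) * a ^ k * b ^ (p - k))"
    by (rule binomial_ring)
  also have "{..p} = {0<..<p} \<union> {0, p}" by auto
  also have "(\<Sum>k\<in>{0<..<p} \<union> {0, p}. of_nat (p choose k) * a ^ k * b ^ (p - k)) =
      (\<Sum>k\<in>{0<..<p}. of_nat (p choose k) * a ^ k * b ^ (p - k)) + (a ^ p + b ^ p)"
    using p by (subst sum.union_disjoint) auto
  finally have "(a + b) ^ p - (a ^ p + b ^ p) =
      (\<Sum>k\<in>{0<..<p}. of_nat (p choose k) * a ^ k * b ^ (p - k))" by simp
  moreover have "[:int p:] dvd of_nat (p choose k) * a ^ k * b ^ (p - k)" if "k \<in> {0<..<p}" for k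
  proof -
    have "p dvd p choose k" using that assms by (intro dvd_choose_prime) auto
    then have "[:int p:] dvd [:int (p choose k):]"
      by (metis const_poly_dvd_const_poly_iff int_dvd_int_iff)
    then show ?thesis unfolding of_nat_poly mult.assoc by (rule dvd_mult2)
  qed
  ultimately show ?thesis by (simp only: dvd_sum)
qed

text \<open>Modulo a prime \<open>p\<close> the substitution \<open>X \<mapsto> X\<^sup>p\<close> is the Frobenius map: both sides are additive in \<open>g\<close>
  modulo \<open>p\<close>, they agree on constants by Fermat's little theorem, and both raise \<open>X\<close> to the
  \<open>p\<close>-th power.\<close>

lemma prime_dvd_pcompose_diff_power:
  fixes g :: "int poly"
  assumes "prime p"
  shows "[:int p:] dvd pcompose g (monom 1 p) - g ^ p"
proof (induction g)
  case 0
  then show ?case using prime_gt_0_nat[OF assms] by (simp add: zero_power)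
next
  case (pCons a g)
  have fermat: "[:int p:] dvd [:a:] - [:a:] ^ p"
  proof -
    have "[a ^ p = a] (mod int p)"
    proof (cases "int p dvd a")
      case True
      then show ?thesis using prime_gt_0_nat[OF assms] by (metis cong_0_iff cong_sym cong_trans dvd_power dvd_trans)
    next
      case False
      define b where "b = nat (a mod int p)"
      have b: "int b = a mod int p" using prime_gt_0_nat[OF assms] by (simp add: b_def)
      then have "\<not> p dvd b" using False by (metis int_dvd_int_iff dvd_mod_iff dvd_refl)
      then have "[b ^ (p - 1) = 1] (mod p)" using assms by (rule fermat_theorem[rotated])
      then have "[int b ^ (p - 1) = 1] (mod int p)" by (metis cong_int_iff of_nat_1 of_nat_power)
      then have "[a ^ (p - 1) = 1] (mod int p)" by (simp add: b cong_def power_mod)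
      then have "[a * a ^ (p - 1) = a * 1] (mod int p)" by (rule cong_scalar_left)
      then show ?thesis using prime_gt_0_nat[OF assms] by (simp flip: power_Suc)
    qed
    then have "int p dvd a - a ^ p" by (meson cong_iff_dvd_diff cong_sym)
    then show ?thesis by (simp add: poly_const_pow)
  qed
  have X: "pcompose (monom 1 1) q = q" for q :: "int poly"
    by (simp add: monom_altdef pcompose_pCons)
  have split: "pCons a g = [:a:] + monom 1 1 * g" by (simp add: monom_altdef)
  have "pcompose (pCons a g) (monom 1 p) - pCons a g ^ p =
     ([:a:] - [:a:] ^ p) + monom 1 p * (pcompose g (monom 1 p) - g ^ p) -
     (([:a:] + monom 1 1 * g) ^ p - ([:a:] ^ p + (monom 1 1 * g) ^ p))"
    by (simp add: split X[simplified] pcompose_add pcompose_mult power_mult_distrib monom_power algebra_simps)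
  moreover have "[:int p:] dvd \<dots>"
    by (intro dvd_diff dvd_add fermat dvd_mult pCons.IH prime_dvd_power_add assms)
  ultimately show ?case by (simp only:)
qed

text \<open>The minimal polynomial of a root of unity is monic with integer coefficients and generates, already
  over \<open>\<int>\<close>, the ideal of all integer polynomials that vanish there. This is Gauss' lemma: a primitive
  integer polynomial \<open>f\<close> of least degree with root \<open>\<xi>\<close> divides a constant multiple of every other such
  polynomial by pseudo-division, and the constant cancels because contents are multiplicative.
  Since \<open>f\<close> divides the monic polynomial \<open>X\<^sup>n - 1\<close>, its leading coefficient is a unit.\<close>

lemma unit_root_min_poly:
  fixes \<xi> :: complex
  assumes "n > 0" "\<xi> ^ n = 1"
  obtains g :: "int poly" where "lead_coeff g = 1" "poly (of_int_poly g) \<xi> = 0"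
    "\<And>F. poly (of_int_poly F) \<xi> = 0 \<Longrightarrow> g dvd F"
proof -
  define X :: "int poly" where "X = monom 1 n - 1"
  define P where "P F \<longleftrightarrow> F \<noteq> 0 \<and> poly (of_int_poly F) \<xi> = 0" for F :: "int poly"
  have cX: "coeff X n = 1" and dX: "degree X \<le> n"
    using assms(1) by (auto simp: X_def degree_diff_le degree_monom_le coeff_eq_0)
  then have lX: "lead_coeff X = 1" "X \<noteq> 0"
    by (metis antisym le_degree zero_neq_one, metis coeff_0 zero_neq_one)
  have "P X"
    using assms lX by (auto simp: P_def X_def hom_distribs poly_monom)
  then obtain f0 where f0: "P f0" "\<And>f. P f \<Longrightarrow> degree f0 \<le> degree f"
    by (metis exists_least_iff[of "\<lambda>d. \<exists>f. P f \<and> degree f = d"] not_le)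
  define f where "f = primitive_part f0"
  have f: "P f" "content f = 1"
  proof -
    have "of_int (content f0) * poly (of_int_poly f) \<xi> = poly (of_int_poly f0) \<xi>"
      by (metis content_times_primitive_part f_def of_int_hom.map_poly_hom_smult poly_smult)
    then show "P f" "content f = 1" using f0(1) by (auto simp: P_def f_def)
  qed
  have dvd: "f dvd F" if F: "poly (of_int_poly F) \<xi> = 0" for F
  proof -
    obtain a q where aq: "a \<noteq> 0" "Polynomial.smult a F = f * q + pseudo_mod F f"
      using pseudo_mod(1)[of f F] f(1) by (auto simp: P_def)
    have "poly (of_int_poly (Polynomial.smult a F)) \<xi> = 0" using F by (simp add: of_int_hom.map_poly_hom_smult)
    then have "poly (of_int_poly (pseudo_mod F f)) \<xi> = 0"
      using f(1) unfolding aq(2) by (simp add: P_def of_int_poly_hom.hom_add of_int_poly_hom.hom_mult)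
    moreover have "pseudo_mod F f = 0 \<or> degree (pseudo_mod F f) < degree f0"
      using pseudo_mod(2)[of f F] f(1) by (auto simp: P_def f_def)
    ultimately have "pseudo_mod F f = 0" using f0(2) P_def not_le by blast
    then have eq: "Polynomial.smult a F = f * q" using aq by simp
    then have "content (Polynomial.smult a F) = content q" using f(2) by (simp add: content_mult)
    then have "a dvd content q" by (metis content_smult dvd_mult2 dvd_normalize_iff dvd_refl dvd_triv_left normalize_dvd_iff)
    then obtain q' where "q = Polynomial.smult a q'"
      by (metis const_poly_dvd_iff_dvd_content dvdE mult_pCons_left add.right_neutral pCons_0_0 mult_zero_left)
    then have "Polynomial.smult a F = Polynomial.smult a (f * q')" using eq by simp
    then have "Polynomial.smult a (F - f * q') = 0" by (simp add: smult_diff_right)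
    then show ?thesis using aq(1) by simp
  qed
  have "f dvd X" by (rule dvd) (use \<open>P X\<close> P_def in auto)
  then have "lead_coeff f dvd 1" by (metis dvdE dvd_triv_left lX(1) lead_coeff_mult)
  then have u: "lead_coeff f = 1 \<or> lead_coeff f = -1" by auto
  show ?thesis
  proof (cases "lead_coeff f = 1")
    case True
    then show ?thesis using that[of f] f(1) dvd by (auto simp: P_def)
  next
    case False
    then show ?thesis using that[of "- f"] f(1) dvd u by (auto simp: P_def of_int_poly_hom.hom_uminus)
  qed
qed

text \<open>The arithmetic heart of the irreducibility of cyclotomic polynomials, phrased as Galois conjugation
  by \<open>\<xi> \<mapsto> \<xi>\<^sup>p\<close>. Let \<open>g\<close> be the minimal polynomial and \<open>X\<^sup>n - 1 = g h\<close>. If \<open>g(\<xi>\<^sup>p) \<noteq> 0\<close>, then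
  \<open>h(\<xi>\<^sup>p) = 0\<close>, and differentiating at \<open>\<xi>\<^sup>p\<close> shows that \<open>g(\<xi>\<^sup>p)\<close> divides \<open>n\<close> in \<open>\<int>[\<xi>]\<close>. But by the Frobenius
  congruence \<open>g(\<xi>\<^sup>p)\<close> is congruent to \<open>g(\<xi>)\<^sup>p = 0\<close> modulo \<open>p\<close>. So \<open>p\<close> divides \<open>n\<close> in \<open>\<int>[\<xi>]\<close>, hence in \<open>\<int>\<close>,
  because \<open>\<int>[\<xi>]\<close> is free over \<open>\<int>\<close> on the powers of \<open>\<xi>\<close> below the degree of \<open>g\<close>.\<close>

lemma int_poly_root_prime_power:
  fixes \<xi> :: complex and F :: "int poly"
  assumes n: "n > 0" "\<xi> ^ n = 1" and p: "prime p" "\<not> p dvd n"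
    and F: "poly (of_int_poly F) \<xi> = 0"
  shows "poly (of_int_poly F) (\<xi> ^ p) = 0"
proof -
  obtain g :: "int poly" where g: "lead_coeff g = 1" "poly (of_int_poly g) \<xi> = 0"
    "\<And>F. poly (of_int_poly F) \<xi> = 0 \<Longrightarrow> g dvd F"
    using unit_root_min_poly n by blast
  have "g \<noteq> 0" using g(1) by auto
  have dg: "degree g > 0"
  proof (rule ccontr)
    assume "\<not> degree g > 0"
    then have "g = [:1:]" using g(1) by (metis degree_0_id of_nat_0 neq0_conv)
    then show False using g(2) by (simp add: map_poly_pCons)
  qed
  define ev where "ev H z = poly (of_int_poly H) z" for H :: "int poly" and z :: complex
  have ev: "ev (a + b) z = ev a z + ev b z" "ev (a - b) z = ev a z - ev b z"
    "ev (a * b) z = ev a z * ev b z" "ev (a ^ k) z = ev a z ^ k" "ev (monom 1 k) z = z ^ k" "ev [:c:] z = of_int c"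
    "ev 1 z = 1" "ev (Polynomial.smult c a) z = of_int c * ev a z"
    for a b z k c
    by (simp_all add: ev_def of_int_poly_hom.hom_add hom_distribs of_int_poly_hom.hom_mult
      of_int_poly_hom.hom_power of_int_hom.map_poly_hom_smult poly_monom)
  have evc: "ev (pcompose a (monom 1 k)) z = ev a (z ^ k)" for a k z
    by (simp add: ev_def of_int_hom.map_poly_pcompose poly_pcompose poly_monom)
  have "ev (monom 1 n - 1) \<xi> = 0" using n by (simp add: ev)
  then obtain h where h: "monom 1 n - 1 = g * h" using g(3)[of "monom 1 n - 1"] unfolding ev_def by (meson dvdE)
  have "ev g (\<xi> ^ p) = 0"
  proof (rule ccontr)
    assume ng: "ev g (\<xi> ^ p) \<noteq> 0"
    have "ev (monom 1 n - 1) (\<xi> ^ p) = 0" using n by (simp add: ev flip: power_mult) (metis mult.commute power_mult power_one)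
    then have "ev h (\<xi> ^ p) = 0" using ng by (simp add: h ev)
    moreover have "pderiv (monom 1 n - 1) = g * pderiv h + h * pderiv g"
      unfolding h by (rule pderiv_mult)
    moreover have "pderiv (monom 1 n - 1 :: int poly) = [:int n:] * monom 1 (n - 1)"
      by (simp add: pderiv_diff pderiv_monom smult_monom)
    ultimately have "ev ([:int n:] * monom 1 (n - 1)) (\<xi> ^ p) = ev (g * pderiv h) (\<xi> ^ p)"
      by (simp add: ev)
    then have 1: "of_nat n * \<xi> ^ (p * (n - 1)) = ev g (\<xi> ^ p) * ev (pderiv h) (\<xi> ^ p)"
      by (simp only: ev power_mult of_int_of_nat_eq)
    obtain r where r: "pcompose g (monom 1 p) - g ^ p = [:int p:] * r"
      using prime_dvd_pcompose_diff_power[OF p(1)] by (meson dvdE)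
    have "ev g (\<xi> ^ p) = ev (pcompose g (monom 1 p) - g ^ p) \<xi>"
      using g(2) prime_gt_0_nat[OF p(1)] by (simp add: ev evc) (simp add: ev_def)
    then have 2: "ev g (\<xi> ^ p) = of_nat p * ev r \<xi>" unfolding r by (simp add: ev)
    have 3: "\<xi> ^ (p * (n - 1)) * \<xi> ^ p = 1"
      using n by (simp flip: power_add) (metis Suc_pred mult.commute mult_Suc_right power_mult power_one add.commute)
    define q where "q = r * pcompose (pderiv h) (monom 1 p) * monom 1 p"
    have "of_nat n = of_nat n * (\<xi> ^ (p * (n - 1)) * \<xi> ^ p)" using 3 by simp
    also have "\<dots> = of_nat p * ev q \<xi>" using 1 2 by (simp add: q_def ev evc)
    finally have 4: "of_nat n = of_nat p * ev q \<xi>" .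
    \<comment> \<open>Reduction modulo the monic \<open>g\<close> rewrites \<open>q(\<xi>)\<close> in the basis \<open>1, \<xi>, \<dots>\<close> of \<open>\<int>[\<xi>]\<close>.\<close>
    obtain s t where st: "pseudo_divmod q g = (s, t)" by fastforce
    have t: "q = g * s + t" "t = 0 \<or> degree t < degree g"
      using pseudo_divmod[OF \<open>g \<noteq> 0\<close> st] g(1) by auto
    have "ev ([:int n:] - [:int p:] * t) \<xi> = 0"
      using 4 g(2) by (simp add: ev t(1)) (simp add: ev_def)
    then have "g dvd [:int n:] - [:int p:] * t" unfolding ev_def by (rule g(3))
    moreover have "degree ([:int n:] - [:int p:] * t) < degree g"
      using dg t(2) by (intro degree_diff_less) auto
    ultimately have "[:int n:] - [:int p:] * t = 0" using dvd_imp_degree_le not_less by blast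
    then have "[:int n:] = [:int p:] * t" by simp
    then have "[:int p:] dvd [:int n:]" by (simp only: dvd_triv_left)
    then show False using p(2) by simp
  qed
  then show ?thesis using g(3)[OF F] by (auto simp: ev_def of_int_poly_hom.hom_mult elim!: dvdE)
qed

lemma int_poly_root_coprime_power:
  fixes \<xi> :: complex and F :: "int poly"
  assumes n: "n > 0" "\<xi> ^ n = 1" and k: "coprime k n"
    and F: "poly (of_int_poly F) \<xi> = 0"
  shows "poly (of_int_poly F) (\<xi> ^ k) = 0"
  using k
proof (induction k rule: prime_divisors_induct)
  case zero
  then show ?case using n F by simp
next
  case (unit x)
  then show ?case using F by simp
next
  case (factor p x)
  have "poly (of_int_poly F) ((\<xi> ^ x) ^ p) = 0"
  proof (rule int_poly_root_prime_power)
    show "n > 0" by fact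
    show "(\<xi> ^ x) ^ n = 1" using n by (metis mult.commute power_mult power_one)
    show "prime p" by fact
    show "\<not> p dvd n" using factor by (metis coprime_mult_left_iff not_prime_unit coprime_absorb_left)
    show "poly (of_int_poly F) (\<xi> ^ x) = 0" using factor by simp
  qed
  then show ?case by (simp flip: power_mult add: mult.commute)
qed

lemma primitive_root_exp:
  assumes "m > 0"
  shows "primitive_root_of_unity m (exp (2 * complex_of_real pi * \<i> / of_nat m))"
proof -
  have pow: "exp (2 * complex_of_real pi * \<i> / of_nat m) ^ k = cis (2 * pi * real k / real m)" for k
    by (simp add: cis_conv_exp mult_ac flip: exp_of_nat_mult)
  have inj: "inj_on (\<lambda>k. cis (2 * pi * real k / real m)) {..<m}"
    using bij_betw_roots_unity[OF assms] by (rule bij_betw_imp_inj_on)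
  have "cis (2 * pi * real k / real m) \<noteq> 1" if "0 < k" "k < m" for k
    using inj_onD[OF inj, of k 0] that by auto
  moreover have "cis (2 * pi * real m / real m) = 1" using assms by simp
  ultimately show ?thesis using assms by (simp add: primitive_root_of_unity_def pow)
qed

lemma primitive_root_power_eq_1_iff:
  assumes "primitive_root_of_unity m z"
  shows "z ^ k = 1 \<longleftrightarrow> m dvd k"
proof
  assume "z ^ k = 1"
  have m: "m > 0" "z ^ m = 1" "\<And>k. 0 < k \<Longrightarrow> k < m \<Longrightarrow> z ^ k \<noteq> 1"
    using assms by (auto simp: primitive_root_of_unity_def)
  have "z ^ k = z ^ (m * (k div m) + k mod m)" by simp
  then have "z ^ (k mod m) = 1" using m(2) \<open>z ^ k = 1\<close> by (simp only: power_add power_mult power_one mult_1)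
  then have "k mod m = 0" using m(1,3) by (metis mod_less_divisor not_gr_zero)
  then show "m dvd k" by auto
next
  assume "m dvd k"
  then show "z ^ k = 1" using assms by (auto simp: primitive_root_of_unity_def power_mult elim!: dvdE)
qed

lemma primitive_root_power_eq_iff:
  assumes "primitive_root_of_unity m z"
  shows "z ^ a = z ^ b \<longleftrightarrow> [a = b] (mod m)"
proof -
  have z: "z \<noteq> 0" using assms by (auto simp: primitive_root_of_unity_def zero_power)
  have "z ^ a = z ^ b \<longleftrightarrow> [a = b] (mod m)" if "a \<le> b" for a b
  proof -
    have "z ^ b = z ^ a * z ^ (b - a)" using that by (simp flip: power_add)
    then have "z ^ a = z ^ b \<longleftrightarrow> z ^ (b - a) = 1" using z by auto
    also have "\<dots> \<longleftrightarrow> m dvd b - a" by (rule primitive_root_power_eq_1_iff[OF assms])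
    also have "\<dots> \<longleftrightarrow> [a = b] (mod m)" using that by (metis cong_altdef_nat cong_sym_eq)
    finally show ?thesis .
  qed
  from this[of a b] this[of b a] show ?thesis using nat_le_linear[of a b] by (metis cong_sym_eq)
qed

section \<open>Minimal squared waiting times on a circular clock\<close>

text \<open>The cycle lemma (the starting station in the petrol station puzzle): the walk whose step at \<open>\<kappa>\<close> is
  the number of \<open>p\<close> with \<open>f p = \<kappa>\<close> minus one returns to its starting height after \<open>N\<close> steps, so reading from a
  minimum of the walk it never goes below its start.\<close>

lemma cyclic_start_exists:
  fixes f :: "'a \<Rightarrow> nat"
  assumes L: "finite L" "card L = N" "N > 0" "\<And>p. p \<in> L \<Longrightarrow> f p < N"
  obtains s where "s < N" "\<And>t. t \<le> N \<Longrightarrow> t \<le> card {p \<in> L. (f p + N - s) mod N < t}"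
proof -
  define c where "c t = card {p \<in> L. f p < t}" for t
  define S where "S t = int (c t) - int t" for t
  define s where "s = arg_min_on S {0..<N}"
  have s: "s < N" and min: "S s \<le> S t" if "t < N" for t
    using arg_min_if_finite(1)[of "{0..<N}" S] arg_min_least[of "{0..<N}" t S] L(3) that
    by (auto simp: s_def)
  have s: "s < N" using s[OF L(3)] .
  have "{p \<in> L. f p < N} = L" using L(4) by auto
  then have SN: "S N = S 0" by (simp add: S_def c_def L(2))
  have split: "c b = c a + card {p \<in> L. a \<le> f p \<and> f p < b}" if "a \<le> b" for a b
    unfolding c_def using that L(1)
    by (subst card_Un_disjoint[symmetric]) (auto intro!: arg_cong[of _ _ card])
  show ?thesis
  proof (rule that[OF s])
    fix t assume t: "t \<le> N"
    have key: "(f p + N - s) mod N = (if s \<le> f p then f p - s else f p + N - s)" if "p \<in> L" for p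
    proof (cases "s \<le> f p")
      case True
      then have "f p + N - s = (f p - s) + N" by simp
      then have "(f p + N - s) mod N = (f p - s) mod N" by (simp only: mod_add_self2)
      then show ?thesis using True L(4)[OF that] by simp
    qed (use L(4)[OF that] s in auto)
    show "t \<le> card {p \<in> L. (f p + N - s) mod N < t}"
    proof (cases "s + t \<le> N")
      case True
      have "{p \<in> L. (f p + N - s) mod N < t} = {p \<in> L. s \<le> f p \<and> f p < s + t}"
        using key True by (auto split: if_splits)
      moreover have "S s \<le> S (s + t)" using min SN min[OF L(3)] True by (cases "s + t = N") auto
      ultimately show ?thesis using split[of s "s + t"] by (simp add: S_def)
    next
      case False
      have union: "{p \<in> L. (f p + N - s) mod N < t} =
          {p \<in> L. s \<le> f p \<and> f p < N} \<union> {p \<in> L. 0 \<le> f p \<and> f p < s + t - N}"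
        using key False t s by (auto split: if_splits dest: L(4))
      have "card {p \<in> L. (f p + N - s) mod N < t} =
          card {p \<in> L. s \<le> f p \<and> f p < N} + card {p \<in> L. 0 \<le> f p \<and> f p < s + t - N}"
        unfolding union using L(1) t by (intro card_Un_disjoint) auto
      then have "card {p \<in> L. (f p + N - s) mod N < t} = (c N - c s) + (c (s + t - N) - c 0)"
        using split[of s N] split[of 0 "s + t - N"] s by simp
      moreover have "S s \<le> S (s + t - N)" using t s by (intro min) auto
      moreover have "S N = 0" "c 0 = 0" using SN by (simp_all add: S_def c_def)
      moreover have "c s \<le> c N" using split[of s N] s by simp
      ultimately show ?thesis using False t by (simp add: S_def)
    qed
  qed
qed

text \<open>Read from that starting point and sorted by arrival time, the \<open>j\<close>-th arrival comes no later than time \<open>j\<close>,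
  since otherwise at most \<open>j\<close> arrivals would have occurred by the end of time \<open>j\<close>.\<close>

lemma cyclic_sorted_enumeration:
  fixes f :: "'a \<Rightarrow> nat"
  assumes L: "finite L" "card L = N" "N > 0" "\<And>p. p \<in> L \<Longrightarrow> f p < N"
  obtains s e where "s < N" "bij_betw e {..<N} L"
    "mono_on {..<N} (\<lambda>j. (f (e j) + N - s) mod N)" "\<And>j. j < N \<Longrightarrow> (f (e j) + N - s) mod N \<le> j"
proof -
  obtain s where s: "s < N" "\<And>t. t \<le> N \<Longrightarrow> t \<le> card {p \<in> L. (f p + N - s) mod N < t}"
    using cyclic_start_exists[of L N f, OF L] by blast
  define key where "key p = (f p + N - s) mod N" for p
  obtain ys where ys: "set ys = L" "distinct ys" using finite_distinct_list[OF L(1)] by blast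
  define xs where "xs = sort_key key ys"
  have xs: "set xs = L" "distinct xs" "sorted (map key xs)" "length xs = N"
    using ys L(2) distinct_card[OF ys(2)] by (simp_all add: xs_def)
  have bij: "bij_betw (\<lambda>j. xs ! j) {..<N} L" using bij_betw_nth[OF xs(2)] xs by auto
  have mono: "key (xs ! i) \<le> key (xs ! j)" if "i \<le> j" "j < N" for i j
    using sorted_nth_mono[OF xs(3), of i j] that xs(4) by simp
  have le: "key (xs ! j) \<le> j" if j: "j < N" for j
  proof (rule ccontr)
    assume "\<not> key (xs ! j) \<le> j"
    have "{p \<in> L. key p < Suc j} \<subseteq> (\<lambda>i. xs ! i) ` {..<j}"
    proof
      fix p assume p: "p \<in> {p \<in> L. key p < Suc j}"
      then obtain i where i: "i < N" "p = xs ! i" using xs by (auto simp: in_set_conv_nth)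
      have "i < j" using mono[of j i] i p \<open>\<not> key (xs ! j) \<le> j\<close> by (cases "j \<le> i") auto
      then show "p \<in> (\<lambda>i. xs ! i) ` {..<j}" using i by auto
    qed
    then have "card {p \<in> L. key p < Suc j} \<le> card ((\<lambda>i. xs ! i) ` {..<j})"
      by (intro card_mono) auto
    also have "\<dots> \<le> j" using card_image_le[of "{..<j}" "\<lambda>i. xs ! i"] by simp
    finally have "card {p \<in> L. key p < Suc j} \<le> j" .
    then show False using s(2)[of "Suc j"] j by (simp add: key_def)
  qed
  show ?thesis
    using that[OF s(1) bij] mono le by (auto simp: key_def mono_on_def)
qed

text \<open>A linear programming dual for the assignment problem with cost \<open>(s - K j)\<^sup>2\<close>. The increment at \<open>t\<close> is
  the marginal cost \<open>2 t + 1 - 2 K\<close> of moving one slot further, with \<open>2 K\<close> replaced by \<open>K t + K (t + 1)\<close>: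
  averaging over two neighbouring slots makes the dual constraint tight exactly inside a block on
  which \<open>K\<close> is constant.\<close>

definition queue_potential :: "(nat \<Rightarrow> nat) \<Rightarrow> nat \<Rightarrow> int" where
  "queue_potential K s = (\<Sum>t<s. 2 * int t + 1 - int (K t) - int (K (Suc t)))"

lemma queue_potential_mono:
  assumes "\<And>t. K t \<le> t" "s \<le> s'"
  shows "queue_potential K s \<le> queue_potential K s'"
  using assms(2)
proof (induction rule: dec_induct)
  case (step s')
  then show ?case using assms(1)[of s'] assms(1)[of "Suc s'"] by (simp add: queue_potential_def)
qed simp

text \<open>Dual feasibility with a quantitative slack: as \<open>s\<close> moves away from \<open>j\<close>, each step in which \<open>K\<close> changes
  costs at least the size of that change. The slack is what forces uniqueness of the optimal
  assignment up to permutations within the blocks.\<close>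

lemma queue_potential_bound:
  assumes "mono K"
  shows "(int s - int (K j))\<^sup>2 - queue_potential K s \<ge>
    (int j - int (K j))\<^sup>2 - queue_potential K j + \<bar>int (K s) - int (K j)\<bar>"
proof (cases "j \<le> s")
  case True
  then show ?thesis
  proof (induction rule: dec_induct)
    case (step s)
    have "K j \<le> K s" "K s \<le> K (Suc s)" using step(1) by (simp_all add: monoD[OF assms])
    then show ?case using step(3) by (simp add: queue_potential_def power2_eq_square algebra_simps)
  qed simp
next
  case False
  then have "s \<le> j" by simp
  then show ?thesis
  proof (induction rule: inc_induct)
    case (step s)
    have "K (Suc s) \<le> K j" "K s \<le> K (Suc s)" using step(1,2) by (simp_all add: monoD[OF assms])
    then show ?case using step(3) by (simp add: queue_potential_def power2_eq_square algebra_simps)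
  qed simp
qed

text \<open>Think of \<open>N\<close> customers arriving at the times \<open>k j \<le> j\<close> on a circular clock with \<open>N\<close> slots, one customer
  being served in each slot. First come, first served minimises the sum of the squared waiting times,
  and any other optimal schedule only permutes customers that arrived together.

  A customer with \<open>\<sigma> j < k j\<close> waits past midnight; lifting that slot to \<open>\<sigma> j + N\<close> removes the reduction
  modulo \<open>N\<close>. The potential bound applies to the lifted slots, and the potential does not increase when the
  slots are brought back to the permutation \<open>\<sigma>\<close> of \<open>{0..<N}\<close>, over which it sums to the same total as for the
  identity.\<close>

lemma queue_cost_minimal:
  fixes k :: "nat \<Rightarrow> nat"
  assumes k: "mono_on {..<N} k" "\<And>j. j < N \<Longrightarrow> k j \<le> j"
    and \<sigma>: "\<sigma> permutes {0..<N}"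
  defines "cost \<equiv> \<lambda>j r. ((r + N - k j) mod N)\<^sup>2"
  shows "(\<Sum>j<N. cost j j) \<le> (\<Sum>j<N. cost j (\<sigma> j))"
    "(\<Sum>j<N. cost j (\<sigma> j)) = (\<Sum>j<N. cost j j) \<longleftrightarrow> (\<forall>j<N. k (\<sigma> j) = k j)"
proof -
  \<comment> \<open>Beyond the first day \<open>K t = t\<close> stays monotone and below the diagonal, and it is larger than
    every arrival time, so a slot past midnight always has positive slack.\<close>
  define K where "K t = (if t < N then k t else t)" for t
  have K: "K t \<le> t" for t using k(2) by (simp add: K_def)
  have mK: "mono K"
  proof (rule monoI)
    fix x y :: nat assume xy: "x \<le> y"
    show "K x \<le> K y"
    proof (cases "y < N")
      case True
      then show ?thesis using mono_onD[OF k(1)] xy by (simp add: K_def)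
    next
      case False
      then show ?thesis using K[of x] xy by (simp add: K_def)
    qed
  qed
  let ?\<phi> = "queue_potential K"
  define lift where "lift j = (if k j \<le> \<sigma> j then \<sigma> j else \<sigma> j + N)" for j
  have \<sigma>N: "\<sigma> j < N" if "j < N" for j using permutes_in_image[OF \<sigma>, of j] that by simp
  have cost_eq: "int (cost j r) = (int (if k j \<le> r then r else r + N) - int (k j))\<^sup>2" if "j < N" "r < N" for j r
  proof -
    have "k j < N" using k(2)[OF that(1)] that by simp
    have "(r + N - k j) mod N = (if k j \<le> r then r else r + N) - k j"
    proof (cases "k j \<le> r")
      case True
      then have "r + N - k j = (r - k j) + N" by simp
      then have "(r + N - k j) mod N = (r - k j) mod N" by (simp only: mod_add_self2)
      then show ?thesis using True that by simp
    qed (use \<open>k j < N\<close> in auto)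
    moreover have "k j \<le> (if k j \<le> r then r else r + N)" using \<open>k j < N\<close> by auto
    ultimately show ?thesis by (auto simp: cost_def of_nat_diff)
  qed
  have cost_id: "int (cost j j) = (int j - int (K j))\<^sup>2" if "j < N" for j
    using cost_eq[OF that that] k(2)[OF that] that by (simp add: K_def)
  have bound: "int (cost j (\<sigma> j)) \<ge> int (cost j j) + ?\<phi> (\<sigma> j) - ?\<phi> j + \<bar>int (K (lift j)) - int (K j)\<bar>"
    if "j < N" for j
  proof -
    have "int (cost j (\<sigma> j)) = (int (lift j) - int (K j))\<^sup>2"
      using cost_eq[OF that \<sigma>N[OF that]] that by (simp add: K_def lift_def)
    moreover have "?\<phi> (\<sigma> j) \<le> ?\<phi> (lift j)"
      by (rule queue_potential_mono) (auto simp: K lift_def)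
    ultimately show ?thesis
      using queue_potential_bound[OF mK, of j "lift j"] cost_id[OF that] by simp
  qed
  have "(\<Sum>j<N. ?\<phi> (\<sigma> j)) = (\<Sum>j<N. ?\<phi> j)"
    using sum.permute[OF \<sigma>, of ?\<phi>] by (simp add: atLeast0LessThan comp_def)
  then have "(\<Sum>j<N. int (cost j j) + ?\<phi> (\<sigma> j) - ?\<phi> j + \<bar>int (K (lift j)) - int (K j)\<bar>) =
      (\<Sum>j<N. int (cost j j)) + (\<Sum>j<N. \<bar>int (K (lift j)) - int (K j)\<bar>)"
    by (simp add: sum.distrib sum_subtractf)
  moreover have "(\<Sum>j<N. int (cost j j) + ?\<phi> (\<sigma> j) - ?\<phi> j + \<bar>int (K (lift j)) - int (K j)\<bar>) \<le> (\<Sum>j<N. int (cost j (\<sigma> j)))"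
    using bound by (intro sum_mono) auto
  ultimately have main: "(\<Sum>j<N. int (cost j j)) + (\<Sum>j<N. \<bar>int (K (lift j)) - int (K j)\<bar>) \<le> (\<Sum>j<N. int (cost j (\<sigma> j)))"
    by simp
  moreover have nonneg: "0 \<le> (\<Sum>j<N. \<bar>int (K (lift j)) - int (K j)\<bar>)" by (simp add: sum_nonneg)
  ultimately have "(\<Sum>j<N. int (cost j j)) \<le> (\<Sum>j<N. int (cost j (\<sigma> j)))" by linarith
  then show "(\<Sum>j<N. cost j j) \<le> (\<Sum>j<N. cost j (\<sigma> j))"
    by (simp flip: of_nat_sum)
  show "(\<Sum>j<N. cost j (\<sigma> j)) = (\<Sum>j<N. cost j j) \<longleftrightarrow> (\<forall>j<N. k (\<sigma> j) = k j)"
  proof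
    assume eq: "(\<Sum>j<N. cost j (\<sigma> j)) = (\<Sum>j<N. cost j j)"
    then have "(\<Sum>j<N. \<bar>int (K (lift j)) - int (K j)\<bar>) = 0"
      using main nonneg by (simp flip: of_nat_sum)
    then have 0: "K (lift j) = K j" if "j < N" for j
      using that by (subst (asm) sum_nonneg_eq_0_iff) auto
    show "\<forall>j<N. k (\<sigma> j) = k j"
    proof (intro allI impI)
      fix j assume j: "j < N"
      have "lift j < N"
      proof (rule ccontr)
        assume "\<not> lift j < N"
        then show False using 0[OF j] j k(2)[OF j] by (simp add: K_def)
      qed
      then have "lift j = \<sigma> j" by (auto simp: lift_def split: if_splits)
      then show "k (\<sigma> j) = k j" using 0[OF j] j \<sigma>N[OF j] by (simp add: K_def)
    qed
  next
    assume same: "\<forall>j<N. k (\<sigma> j) = k j"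
    have "int (cost j (\<sigma> j)) = int (\<sigma> j)^2 - 2 * int (\<sigma> j) * int (k (\<sigma> j)) + int (k j)^2" if "j < N" for j
      using cost_eq[OF that \<sigma>N[OF that]] k(2)[OF \<sigma>N[OF that]] same that
      by (simp add: power2_eq_square algebra_simps)
    then have "(\<Sum>j<N. int (cost j (\<sigma> j))) = (\<Sum>j<N. (\<lambda>r. int r^2 - 2 * int r * int (k r)) (\<sigma> j)) + (\<Sum>j<N. int (k j)^2)"
      by (simp add: sum.distrib sum_subtractf)
    also have "(\<Sum>j<N. (\<lambda>r. int r^2 - 2 * int r * int (k r)) (\<sigma> j)) = (\<Sum>j<N. int j^2 - 2 * int j * int (k j))"
      using sum.permute[OF \<sigma>, of "\<lambda>r. int r^2 - 2 * int r * int (k r)"] by (simp add: atLeast0LessThan comp_def)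
    also have "\<dots> + (\<Sum>j<N. int (k j)^2) = (\<Sum>j<N. int (cost j j))"
      unfolding sum.distrib[symmetric]
      by (intro sum.cong refl) (use k(2) cost_id in \<open>auto simp: K_def power2_eq_square algebra_simps\<close>)
    finally show "(\<Sum>j<N. cost j (\<sigma> j)) = (\<Sum>j<N. cost j j)"
      by (simp flip: of_nat_sum)
  qed
qed

section \<open>The determinant as a polynomial\<close>

text \<open>After sorting, the rows and columns with equal \<open>k\<close> form diagonal blocks whose column indices are
  consecutive. A kernel vector restricted to a block of size \<open>l\<close> gives, after dividing by the least power,
  a polynomial of degree below \<open>l\<close> with \<open>l\<close> distinct roots \<open>y j\<close>.\<close>

lemma block_vandermonde_det_nonzero:
  fixes y :: "nat \<Rightarrow> complex" and k :: "nat \<Rightarrow> nat"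
  assumes k: "mono_on {..<N} k" and y0: "\<And>j. j < N \<Longrightarrow> y j \<noteq> 0"
    and inj: "inj_on (\<lambda>j. (k j, y j)) {..<N}"
  shows "det (mat N N (\<lambda>(j, r). if k r = k j then y j ^ (r + s) else 0)) \<noteq> 0" (is "det ?A \<noteq> 0")
proof
  assume "det ?A = 0"
  then obtain v where v: "v \<in> carrier_vec N" "v \<noteq> 0\<^sub>v N" "?A *\<^sub>v v = 0\<^sub>v N"
    using det_0_iff_vec_prod_zero_field[of ?A N] by auto
  have "v $ i = 0" if i: "i < N" for i
  proof -
    define C where "C = {r. r < N \<and> k r = k i}"
    have C: "finite C" "i \<in> C" using i by (auto simp: C_def)
    define b where "b = Min C"
    have b: "b \<in> C" "\<And>r. r \<in> C \<Longrightarrow> b \<le> r" using C by (auto simp: b_def intro: Min_in)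
    define q where "q = (\<Sum>r\<in>C. monom (v $ r) (r - b))"
    have interval: "C = {b..<b + card C}"
    proof -
      define e where "e = Max C"
      have e: "e \<in> C" "\<And>r. r \<in> C \<Longrightarrow> r \<le> e" using C by (auto simp: e_def intro: Max_in)
      have "C = {b..e}"
      proof (intro equalityI subsetI)
        fix r assume r: "r \<in> {b..e}"
        have "k b \<le> k r" "k r \<le> k e"
          using mono_onD[OF k, of b r] mono_onD[OF k, of r e] r b(1) e(1) by (auto simp: C_def)
        then show "r \<in> C" using r b(1) e(1) by (auto simp: C_def)
      qed (use b e in auto)
      moreover have "b \<le> e" using b e by blast
      ultimately show ?thesis by auto
    qed
    have root: "poly q (y j) = 0" if j: "j \<in> C" for j
    proof -
      have jN: "j < N" using j by (simp add: C_def)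
      have "0 = (?A *\<^sub>v v) $ j" using v(3) jN by simp
      also have "\<dots> = (\<Sum>r<N. (if k r = k j then y j ^ (r + s) else 0) * v $ r)"
        using v(1) jN by (simp add: scalar_prod_def atLeast0LessThan)
      also have "\<dots> = (\<Sum>r\<in>C. y j ^ (r + s) * v $ r)"
        using j by (intro sum.mono_neutral_cong_right) (auto simp: C_def)
      also have "\<dots> = (\<Sum>r\<in>C. y j ^ (b + s) * (v $ r * y j ^ (r - b)))"
      proof (intro sum.cong refl)
        fix r assume "r \<in> C"
        then have "r + s = (b + s) + (r - b)" using b(2) by simp
        then have "y j ^ (r + s) = y j ^ (b + s) * y j ^ (r - b)" by (metis power_add)
        then show "y j ^ (r + s) * v $ r = y j ^ (b + s) * (v $ r * y j ^ (r - b))" by simp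
      qed
      also have "\<dots> = y j ^ (b + s) * poly q (y j)"
        by (simp add: q_def poly_sum poly_monom sum_distrib_left)
      finally show ?thesis using y0[OF jN] by simp
    qed
    have "q = 0"
    proof (rule ccontr)
      assume q: "q \<noteq> 0"
      have "card C = card (y ` C)"
        by (rule card_image[symmetric]) (use inj in \<open>auto simp: inj_on_def C_def\<close>)
      also have "\<dots> \<le> card {x. poly q x = 0}"
        using root poly_roots_finite[OF q] by (intro card_mono) auto
      also have "\<dots> \<le> degree q" using q by (rule card_poly_roots_bound)
      also have "\<dots> < card C"
      proof -
        have "degree q \<le> card C - 1" unfolding q_def
        proof (rule degree_sum_le)
          fix r assume "r \<in> C"
          then have "r < b + card C" using interval by (metis atLeastLessThan_iff)
          then have "r - b \<le> card C - 1" by simp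
          then show "degree (monom (v $ r) (r - b)) \<le> card C - 1"
            using degree_monom_le order.trans by blast
        qed (rule C(1))
        moreover have "card C > 0" using C card_gt_0_iff by blast
        ultimately show ?thesis by simp
      qed
      finally show False by simp
    qed
    have coeff: "coeff (monom (v $ r) (r - b)) (i - b) = (if r = i then v $ r else 0)" if "r \<in> C" for r
    proof -
      have "r - b = i - b \<longleftrightarrow> r = i" using b(2)[OF that] b(2)[OF C(2)] by arith
      then show ?thesis by simp
    qed
    have "0 = coeff q (i - b)" using \<open>q = 0\<close> by simp
    also have "\<dots> = (\<Sum>r\<in>C. if r = i then v $ r else 0)"
      unfolding q_def coeff_sum by (intro sum.cong refl coeff)
    also have "\<dots> = v $ i" using C by simp
    finally show ?thesis by simp
  qed
  then have "v = 0\<^sub>v N" using v(1) by (intro eq_vecI) auto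
  then show False using v(2) by simp
qed

text \<open>Replace \<open>\<zeta>\<close> by an indeterminate. In the Leibniz expansion the permutation \<open>p\<close> contributes a monomial
  whose exponent is the total cost of \<open>p\<close>. The permutations of least cost are those that preserve the
  blocks, so the lowest coefficient is exactly the determinant of the block Vandermonde matrix.\<close>

lemma gabor_det_poly_nonzero:
  fixes y :: "nat \<Rightarrow> complex" and s :: nat
  assumes k: "mono_on {..<N} k" "\<And>j. j < N \<Longrightarrow> k j \<le> j"
    and y0: "\<And>j. j < N \<Longrightarrow> y j \<noteq> 0"
    and inj: "inj_on (\<lambda>j. (k j, y j)) {..<N}"
  defines "D \<equiv> det (mat N N (\<lambda>(j, r). monom (y j ^ (r + s)) (((r + N - k j) mod N)\<^sup>2)))"
  shows "D \<noteq> 0" "degree D \<le> N * (N - 1)\<^sup>2"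
proof -
  define cost where "cost j r = ((r + N - k j) mod N)\<^sup>2" for j r
  let ?P = "{p. p permutes {0..<N}}"
  have finP: "finite ?P" by (simp add: finite_permutations)
  have prod_monom: "(\<Prod>j\<in>A. monom (c j) (d j)) = monom (\<Prod>j\<in>A. c j) (\<Sum>j\<in>A. d j)"
    for A :: "nat set" and c :: "nat \<Rightarrow> complex" and d
    by (induction A rule: infinite_finite_induct) (auto simp: mult_monom)
  have "D = (\<Sum>p\<in>?P. signof p * (\<Prod>j=0..<N. monom (y j ^ (p j + s)) (cost j (p j))))"
    unfolding D_def by (subst det_def') (auto simp: cost_def intro!: sum.cong prod.cong)
  also have "\<dots> = (\<Sum>p\<in>?P. monom (signof p * (\<Prod>j<N. y j ^ (p j + s))) (\<Sum>j<N. cost j (p j)))"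
    unfolding prod_monom atLeast0LessThan by (intro sum.cong refl) (simp add: sign_def minus_monom)
  finally have D: "D = \<dots>" .
  have "coeff D (\<Sum>j<N. cost j j) =
     (\<Sum>p\<in>?P. if \<forall>j<N. k (p j) = k j then signof p * (\<Prod>j<N. y j ^ (p j + s)) else 0)"
    unfolding D coeff_sum coeff_monom
    by (intro sum.cong refl if_cong) (use queue_cost_minimal(2)[OF k] in \<open>auto simp: cost_def\<close>)
  also have "\<dots> = (\<Sum>p\<in>?P. signof p * (\<Prod>j=0..<N. if k (p j) = k j then y j ^ (p j + s) else 0))"
  proof (intro sum.cong refl)
    fix p
    show "(if \<forall>j<N. k (p j) = k j then signof p * (\<Prod>j<N. y j ^ (p j + s)) else 0) =
      signof p * (\<Prod>j=0..<N. if k (p j) = k j then y j ^ (p j + s) else 0)"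
    proof (cases "\<forall>j<N. k (p j) = k j")
      case False
      then have "(\<Prod>j=0..<N. if k (p j) = k j then y j ^ (p j + s) else 0) = 0"
        by (intro prod_zero) auto
      then show ?thesis by (simp only: if_not_P[OF False] mult_zero_right)
    qed (simp add: atLeast0LessThan)
  qed
  also have "\<dots> = det (mat N N (\<lambda>(j, r). if k r = k j then y j ^ (r + s) else 0))"
    by (subst det_def') (auto intro!: sum.cong prod.cong)
  finally show "D \<noteq> 0"
    using block_vandermonde_det_nonzero[OF k(1) y0 inj, of s] by auto
  show "degree D \<le> N * (N - 1)\<^sup>2"
    unfolding D
  proof (rule degree_sum_le[OF finP])
    fix p
    have "cost j r \<le> (N - 1)\<^sup>2" if "j < N" for j r
    proof -
      have "(r + N - k j) mod N < N" using that by simp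
      then have "(r + N - k j) mod N \<le> N - 1" by simp
      then show ?thesis unfolding cost_def by (rule power_mono) simp
    qed
    then have "(\<Sum>j<N. cost j (p j)) \<le> (\<Sum>j<N. (N - 1)\<^sup>2)" by (intro sum_mono) auto
    then show "degree (monom (signof p * (\<Prod>j<N. y j ^ (p j + s))) (\<Sum>j<N. cost j (p j))) \<le> N * (N - 1)\<^sup>2"
      by (intro order.trans[OF degree_monom_le]) simp
  qed
qed

section \<open>Nonvanishing at the root of unity\<close>

text \<open>The fields generated by \<open>\<omega>\<close> and \<open>\<zeta>\<close> are linearly disjoint: for every \<open>u\<close> prime to \<open>M\<close> there is a
  conjugation that fixes \<open>\<omega>\<close> and sends \<open>\<zeta>\<close> to \<open>\<zeta>\<^sup>u\<close>. Both are powers of \<open>\<xi> = \<omega> \<zeta>\<close>, so the determinant is the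
  value at \<open>\<xi>\<close> of an integer polynomial \<open>F\<close>, and the conjugation is \<open>\<xi> \<mapsto> \<xi>\<^sup>w\<close> with \<open>w\<close> congruent to \<open>1\<close>
  modulo \<open>N\<close> and to \<open>u\<close> modulo \<open>M\<close>.\<close>

lemma det_root_powers_conjugate:
  fixes \<omega> \<zeta> :: complex
  assumes prim: "primitive_root_of_unity N \<omega>" "primitive_root_of_unity M \<zeta>"
    and cop: "coprime N M" and u: "coprime u M"
    and det0: "det (mat n n (\<lambda>(j, r). \<omega> ^ c j r * \<zeta> ^ d j r)) = 0"
  shows "det (mat n n (\<lambda>(j, r). \<omega> ^ c j r * (\<zeta> ^ u) ^ d j r)) = 0"
proof -
  obtain a where a: "[a = 1] (mod N)" "[a = 0] (mod M)"
    using binary_chinese_remainder_nat[OF cop] by blast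
  obtain b where b: "[b = 0] (mod N)" "[b = 1] (mod M)"
    using binary_chinese_remainder_nat[OF cop] by blast
  obtain w where w: "[w = 1] (mod N)" "[w = u] (mod M)"
    using binary_chinese_remainder_nat[OF cop] by blast
  note eq_iff = primitive_root_power_eq_iff[OF prim(1)] primitive_root_power_eq_iff[OF prim(2)]
  have exps: "\<omega> ^ a = \<omega>" "\<zeta> ^ a = 1" "\<omega> ^ b = 1" "\<zeta> ^ b = \<zeta>" "\<omega> ^ w = \<omega>" "\<zeta> ^ w = \<zeta> ^ u"
    using eq_iff(1)[of a 1] eq_iff(2)[of a 0] eq_iff(1)[of b 0] eq_iff(2)[of b 1]
      eq_iff(1)[of w 1] eq_iff(2)[of w u] a b w by simp_all
  define F :: "int poly" where "F = det (mat n n (\<lambda>(j, r). monom 1 (a * c j r + b * d j r)))"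
  have evF: "poly (of_int_poly F) (\<omega> * \<zeta> ^ v) = det (mat n n (\<lambda>(j, r). \<omega> ^ c j r * (\<zeta> ^ v) ^ d j r))"
    for v
  proof -
    let ?z = "\<omega> * \<zeta> ^ v"
    interpret ev: comm_ring_hom "\<lambda>F :: int poly. poly (of_int_poly F) ?z"
      by unfold_locales (auto simp: hom_distribs)
    have za: "?z ^ a = \<omega>"
      using exps by (simp add: power_mult_distrib flip: power_mult) (simp add: mult.commute power_mult)
    have zb: "?z ^ b = \<zeta> ^ v"
      using exps by (simp add: power_mult_distrib flip: power_mult) (simp add: mult.commute power_mult)
    have "poly (of_int_poly F) ?z =
        det (map_mat (\<lambda>F. poly (of_int_poly F) ?z) (mat n n (\<lambda>(j, r). monom 1 (a * c j r + b * d j r))))"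
      unfolding F_def by (rule ev.hom_det[symmetric])
    also have "map_mat (\<lambda>F. poly (of_int_poly F) ?z) (mat n n (\<lambda>(j, r). monom (1 :: int) (a * c j r + b * d j r))) =
        mat n n (\<lambda>(j, r). \<omega> ^ c j r * (\<zeta> ^ v) ^ d j r)"
      by (intro eq_matI) (simp_all add: poly_monom power_add power_mult za zb)
    finally show ?thesis .
  qed
  have NM: "N * M > 0" "(\<omega> * \<zeta>) ^ (N * M) = 1"
    using prim by (auto simp: primitive_root_of_unity_def power_mult_distrib power_mult)
      (metis mult.commute power_mult power_one)
  have "coprime w (N * M)"
  proof -
    have "coprime w N" using w(1) by (metis cong_imp_coprime cong_sym coprime_1_left)
    moreover have "coprime w M" using w(2) u by (metis cong_imp_coprime cong_sym)
    ultimately show ?thesis by simp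
  qed
  moreover have "poly (of_int_poly F) (\<omega> * \<zeta>) = 0" using evF[of 1] det0 by simp
  ultimately have "poly (of_int_poly F) ((\<omega> * \<zeta>) ^ w) = 0"
    using int_poly_root_coprime_power NM by blast
  then show ?thesis using evF[of u] exps by (simp add: power_mult_distrib)
qed

text \<open>With \<open>m = N - 1\<close>, a vanishing determinant at \<open>\<zeta>\<close> vanishes at all \<open>\<phi>(m\<^sup>4) = m\<^sup>3 \<phi>(m)\<close> conjugates of \<open>\<zeta>\<close>. That is
  more than the degree, at most \<open>(m + 1) m\<^sup>2\<close>, of the nonzero polynomial \<open>D\<close> in the variable \<open>\<zeta>\<close>: as \<open>m \<ge> 3\<close>,
  \<open>m \<phi>(m) \<ge> 2 m > m + 1\<close>.\<close>

lemma gabor_det_nonzero: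
  fixes \<omega> \<zeta> :: complex
  assumes N: "N \<ge> 4"
    and prim: "primitive_root_of_unity N \<omega>" "primitive_root_of_unity ((N - 1) ^ 4) \<zeta>"
    and k: "mono_on {..<N} k" "\<And>j. j < N \<Longrightarrow> k j \<le> j"
    and inj: "inj_on (\<lambda>j. (k j, \<omega> ^ l j)) {..<N}"
  shows "det (mat N N (\<lambda>(j, r). \<omega> ^ (l j * (r + s)) * \<zeta> ^ ((r + N - k j) mod N)\<^sup>2)) \<noteq> 0"
proof
  assume det0: "det (mat N N (\<lambda>(j, r). \<omega> ^ (l j * (r + s)) * \<zeta> ^ ((r + N - k j) mod N)\<^sup>2)) = 0"
  define m where "m = N - 1"
  have m: "m \<ge> 3" "N = m + 1" using N by (auto simp: m_def)
  define D where "D = det (mat N N (\<lambda>(j, r). monom ((\<omega> ^ l j) ^ (r + s)) (((r + N - k j) mod N)\<^sup>2)))"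
  have \<omega>0: "\<omega> \<noteq> 0" using prim(1) by (auto simp: primitive_root_of_unity_def zero_power)
  have D: "D \<noteq> 0" "degree D \<le> N * m\<^sup>2"
    using gabor_det_poly_nonzero[OF k _ inj, of s] \<omega>0 by (simp_all add: D_def m_def)
  have cop: "coprime N (m ^ 4)" using m by simp
  have root: "poly D (\<zeta> ^ u) = 0" if "coprime u (m ^ 4)" for u
  proof -
    have "poly D (\<zeta> ^ u) = det (mat N N (\<lambda>(j, r). \<omega> ^ (l j * (r + s)) * (\<zeta> ^ u) ^ ((r + N - k j) mod N)\<^sup>2))"
      unfolding D_def comm_ring_hom.hom_det[OF poly_hom.comm_ring_hom_axioms, symmetric]
      by (intro arg_cong[of _ _ det] eq_matI) (simp_all add: poly_monom power_mult)
    also have "\<dots> = 0"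
      using det_root_powers_conjugate[OF prim[folded m_def] cop that det0] .
    finally show ?thesis .
  qed
  have "m ^ 3 * totient m = totient (m ^ 4)" by (simp add: totient_power)
  also have "\<dots> = card ((\<lambda>u. \<zeta> ^ u) ` totatives (m ^ 4))"
    unfolding totient_def
  proof (rule card_image[symmetric], rule inj_onI)
    fix u v assume uv: "u \<in> totatives (m ^ 4)" "v \<in> totatives (m ^ 4)" "\<zeta> ^ u = \<zeta> ^ v"
    have "m ^ 4 > 1" using m by (intro one_less_power) auto
    then have "u < m ^ 4" "v < m ^ 4" using uv totatives_less by blast+
    then show "u = v"
      using uv(3) primitive_root_power_eq_iff[OF prim(2)] cong_less_modulus_unique_nat
      by (auto simp: m_def)
  qed
  also have "\<dots> \<le> card {z. poly D z = 0}"
    using root poly_roots_finite[OF D(1)] by (intro card_mono) (auto simp: totatives_def)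
  also have "\<dots> \<le> degree D" using D(1) by (rule card_poly_roots_bound)
  also have "\<dots> \<le> N * m\<^sup>2" by (rule D(2))
  finally have "m\<^sup>2 * (m * totient m) \<le> m\<^sup>2 * (m + 1)"
    by (simp add: m(2) power2_eq_square power3_eq_cube mult_ac)
  then have "m * totient m \<le> m + 1" unfolding mult_le_cancel1 using m(1) by simp
  moreover have "m * 2 \<le> m * totient m" using totient_gt_1[of m] m(1) by simp
  ultimately show False using m(1) by simp
qed

section \<open>Gabor frames in general linear position\<close>

text \<open>The determinant may be computed with the coordinates rearranged by \<open>\<pi>\<close>; below, \<open>\<pi>\<close> is the rotation of
  \<open>\<int>/N\<close> that starts at the point chosen by the cycle lemma.\<close>

lemma basis_family_if_det_nonzero:
  fixes f :: "'i \<Rightarrow> complex vec"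
  assumes f: "\<And>i. i \<in> I \<Longrightarrow> f i \<in> carrier_vec N" and e: "bij_betw e {..<N} I"
    and \<pi>: "bij_betw \<pi> {..<N} {..<N}"
    and det: "det (mat N N (\<lambda>(j, r). f (e j) $ \<pi> r)) \<noteq> 0"
  shows "basis_family N I f"
proof -
  interpret vec_space "TYPE(complex)" N .
  let ?B = "mat N N (\<lambda>(j, r). f (e j) $ \<pi> r)"
  define A where "A = mat N N (\<lambda>(i, j). f (e j) $ i)"
  have A: "A \<in> carrier_mat N N" by (simp add: A_def)
  have eI: "e j \<in> I" if "j < N" for j using e that by (auto simp: bij_betw_def)
  have colA: "col A j = f (e j)" if "j < N" for j
    using f[OF eI[OF that]] that by (intro eq_vecI) (auto simp: A_def)
  have "det A \<noteq> 0"
  proof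
    assume "det A = 0"
    then obtain v where v: "v \<in> carrier_vec N" "v \<noteq> 0\<^sub>v N" "A *\<^sub>v v = 0\<^sub>v N"
      using det_0_iff_vec_prod_zero_field[OF A] by auto
    have "?B\<^sup>T *\<^sub>v v = 0\<^sub>v N"
    proof (rule eq_vecI)
      fix r assume "r < dim_vec (0\<^sub>v N :: complex vec)"
      then have r: "r < N" by simp
      then have \<pi>r: "\<pi> r < N" using \<pi> by (auto simp: bij_betw_def)
      have "(?B\<^sup>T *\<^sub>v v) $ r = (A *\<^sub>v v) $ \<pi> r"
        using v(1) r \<pi>r by (simp add: A_def scalar_prod_def)
      then show "(?B\<^sup>T *\<^sub>v v) $ r = 0\<^sub>v N $ r" using v(3) r \<pi>r by simp
    qed simp
    then have "det ?B\<^sup>T = 0"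
      using det_0_iff_vec_prod_zero_field[of "?B\<^sup>T" N] v by auto
    then show False using det det_transpose[of ?B N] by simp
  qed
  then have rank: "rank A = N" using det_rank_iff[OF A] by simp
  have dist: "distinct (cols A)" using non_distinct_low_rank[OF A] rank by auto
  have li: "lin_indpt (set (cols A))" by (rule full_rank_lin_indpt[OF A rank dist])
  have cols: "cols A = map (\<lambda>j. f (e j)) [0..<N]"
    using A colA by (auto simp: cols_def)
  have set_cols: "set (cols A) = f ` I"
    using e by (auto simp: cols bij_betw_def image_image[symmetric] atLeast0LessThan simp del: image_image)
  have "inj_on (f \<circ> e) {..<N}" using dist by (auto simp: cols distinct_map atLeast0LessThan comp_def)
  then have inj: "inj_on f I" using e by (auto simp: bij_betw_def inj_on_imageI)
  have "basis (set (cols A))"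
    using li cols_dim[of A] A distinct_card[OF dist] by (intro dim_li_is_basis) (auto simp: dim_is_n)
  then show ?thesis using inj by (simp add: basis_family_def set_cols)
qed

text \<open>In coordinates rotated by \<open>s\<close>, the translation by \<open>\<kappa>\<close> becomes the translation by
  \<open>(\<kappa> + N - s) mod N\<close>, and the modulation keeps its shape up to the offset \<open>s\<close> in the exponent.\<close>

lemma time_freq_shift_chirp:
  assumes "s < N" "r < N" "\<kappa> < N"
  shows "time_freq_shift N (\<kappa>, l) (Matrix.vec N (\<lambda>n. \<zeta> ^ n\<^sup>2)) $ ((r + s) mod N) =
    exp (2 * complex_of_real pi * \<i> / of_nat N) ^ (l * (r + s)) *
    \<zeta> ^ ((r + N - (\<kappa> + N - s) mod N) mod N)\<^sup>2"
proof -
  have N: "N > 0" using assms by simp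
  let ?\<omega> = "exp (2 * complex_of_real pi * \<i> / of_nat N)"
  have "int ((r + N - (\<kappa> + N - s) mod N) mod N) = (int r + int N - int ((\<kappa> + N - s) mod N)) mod int N"
    using mod_less_divisor[OF N, of "\<kappa> + N - s"] by (simp add: zmod_int of_nat_diff)
  also have "\<dots> = (int r + int N - (int \<kappa> + int N - int s)) mod int N"
    using assms by (simp add: zmod_int of_nat_diff mod_diff_right_eq)
  also have "\<dots> = (int ((r + s) mod N) - int \<kappa>) mod int N"
    by (simp add: zmod_int mod_diff_left_eq algebra_simps)
  finally have idx: "nat ((int ((r + s) mod N) - int \<kappa>) mod int N) = (r + N - (\<kappa> + N - s) mod N) mod N"
    by (metis nat_int)
  have "?\<omega> ^ N = 1" using N primitive_root_exp[OF N] by (simp add: primitive_root_of_unity_def)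
  then have "?\<omega> ^ ((r + s) mod N * l) = ?\<omega> ^ (l * (r + s))"
    using primitive_root_power_eq_iff[OF primitive_root_exp[OF N]]
    by (metis cong_def mod_mult_left_eq mult.commute)
  then show ?thesis
    using assms N by (simp add: time_freq_shift_def shift_op_funpow modulation_op_funpow idx)
qed

theorem corollary5p3:
  fixes N :: nat and \<zeta> :: complex
  assumes "N \<ge> 4"
    and "\<zeta> = exp (2 * complex_of_real pi * \<i> / of_nat ((N - 1) ^ 4)) \<or>
         primitive_root_of_unity ((N - 1) ^ 4) \<zeta>"
  shows "gabor_general_linear_position N (Matrix.vec N (\<lambda>n. \<zeta> ^ (n ^ 2)))"
proof -
  let ?\<phi> = "Matrix.vec N (\<lambda>n. \<zeta> ^ (n ^ 2))"
  define \<omega> where "\<omega> = exp (2 * complex_of_real pi * \<i> / of_nat N)"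
  have N: "N > 0" using assms(1) by simp
  have prim: "primitive_root_of_unity N \<omega>" "primitive_root_of_unity ((N - 1) ^ 4) \<zeta>"
    using assms primitive_root_exp[of N] primitive_root_exp[of "(N - 1) ^ 4"] by (auto simp: \<omega>_def)
  have "basis_family N L (\<lambda>p. time_freq_shift N p ?\<phi>)"
    if L: "L \<subseteq> {0..<N} \<times> {0..<N}" "card L = N" for L
  proof -
    have finL: "finite L" using L(1) by (rule finite_subset) simp
    have "fst p < N" "snd p < N" if "p \<in> L" for p using L(1) that by auto
    note less = this
    obtain s e where s: "s < N" and e: "bij_betw e {..<N} L"
      and k: "mono_on {..<N} (\<lambda>j. (fst (e j) + N - s) mod N)"
        "\<And>j. j < N \<Longrightarrow> (fst (e j) + N - s) mod N \<le> j"
      using cyclic_sorted_enumeration[of L N fst, OF finL L(2) N less(1)] by blast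
    define k where "k j = (fst (e j) + N - s) mod N" for j
    have eL: "e j \<in> L" if "j < N" for j using e that by (auto simp: bij_betw_def)
    have inj: "inj_on (\<lambda>j. (k j, \<omega> ^ snd (e j))) {..<N}"
    proof (rule inj_onI)
      fix i j assume ij: "i \<in> {..<N}" "j \<in> {..<N}"
        "(k i, \<omega> ^ snd (e i)) = (k j, \<omega> ^ snd (e j))"
      have "[fst (e i) + (N - s) = fst (e j) + (N - s)] (mod N)"
        using ij(3) s by (simp add: k_def cong_def)
      then have "fst (e i) = fst (e j)"
        using less(1)[OF eL] ij(1,2) cong_add_rcancel_nat cong_less_modulus_unique_nat by auto
      moreover have "snd (e i) = snd (e j)"
        using ij less(2)[OF eL] primitive_root_power_eq_iff[OF prim(1)] cong_less_modulus_unique_nat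
        by auto
      ultimately show "i = j" using e ij(1,2) by (metis bij_betw_def inj_onD prod_eqI)
    qed
    have rot: "bij_betw (\<lambda>r. (r + s) mod N) {..<N} {..<N}"
    proof -
      have "inj_on (\<lambda>r. (r + s) mod N) {..<N}"
        by (rule inj_onI) (metis cong_def cong_add_rcancel_nat cong_less_modulus_unique_nat lessThan_iff)
      moreover have "(\<lambda>r. (r + s) mod N) ` {..<N} \<subseteq> {..<N}" using N by auto
      ultimately show ?thesis by (simp add: bij_betw_def endo_inj_surj)
    qed
    show ?thesis
    proof (rule basis_family_if_det_nonzero[OF _ e rot])
      show "time_freq_shift N p ?\<phi> \<in> carrier_vec N" for p
        using N by (cases p) (simp add: time_freq_shift_def shift_op_funpow modulation_op_funpow)
      have entry: "time_freq_shift N (e j) ?\<phi> $ ((r + s) mod N) =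
          \<omega> ^ (snd (e j) * (r + s)) * \<zeta> ^ ((r + N - k j) mod N)\<^sup>2" if "j < N" "r < N" for j r
        using time_freq_shift_chirp[OF s that(2) less(1)[OF eL[OF that(1)]], of "snd (e j)" \<zeta>]
        by (simp add: \<omega>_def k_def)
      have "mat N N (\<lambda>(j, r). time_freq_shift N (e j) ?\<phi> $ ((r + s) mod N)) =
          mat N N (\<lambda>(j, r). \<omega> ^ (snd (e j) * (r + s)) * \<zeta> ^ ((r + N - k j) mod N)\<^sup>2)"
        by (intro eq_matI) (simp_all add: entry)
      then show "det (mat N N (\<lambda>(j, r). time_freq_shift N (e j) ?\<phi> $ ((r + s) mod N))) \<noteq> 0"
        using gabor_det_nonzero[OF assms(1) prim k[folded k_def] inj] by simp
    qed
  qed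
  then show ?thesis by (simp add: gabor_general_linear_position_def)
qed

end
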